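(* Consider the DR-RC-Iterative-MPC scheme described in the context, and assume that the initial sampled safe set $\mathcal{S}^0$ consists of the states (with their cost-to-go) of a finite-length robustly safe trajectory from $x_S$ to $x_F$, in the sense specified in the context. Then, for each iteration $j\ge 1$ of the DR-RC-Iterative-MPC procedure, the trajectory $(\mathsf{x}^j,\mathsf{u}^j)$ generated by the routine $\mathtt{DR\_MPC}$ (with inputs $\mathcal{S}^{j-1}$ and $\mathcal{D}^{j-1}$) satisfies $x_t^j\to x_F$ as $t\to\infty$.
   Context: **System and cost.** The system is $x_{t+1}=f(x_t,u_t)$ with $f:\mathbb{R}^{n_x}\times\mathbb{R}^{n_u}\to\mathbb{R}^{n_x}$, subject to $x_t\in\mathcal{X}$, $u_t\in\mathcal{U}$, where $\mathcal{X},\mathcal{U}$ are compact convex sets. $x_S\in\mathcal{X}$ is the initial state and $x_F\in\mathcal{X}$ is a target equilibrium, $f(x_F,0)=x_F$, $0\in\mathcal{U}$. The stage cost $r:\mathcal{X}\times\mathcal{U}\to\mathbb{R}_{\ge0}$ is continuous with $r(x_F,0)=0$ and $r(x,u)>0$ for all $(x,u)\in(\mathcal{X}\times\mathcal{U})\setminus\{(x_F,0)\}$. **Risk.** $w$ is a random variable with distribution $\mathbb{P}$ supported on a compact set $\mathcal{W}\subset\mathbb{R}^{n_w}$; $g:\mathcal{X}\times\mathcal{W}\to\mathbb{R}$ is continuous; $\delta>0$; $\beta\in(0,1)$. For a distribution $\mu$, $\operatorname{CVaR}_\beta^\mu[Z]=\inf_{t\in\mathbb{R}}\{t+\beta^{-1}\mathbb{E}^\mu[\max(Z-t,0)]\}$.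 **Ambiguity sets.** Let $\mathcal{P}(\mathcal{W})$ be the set of distributions supported on $\mathcal{W}$. A confidence parameter $\zeta\in(0,1)$ and a set-valued map $\mathbb{D}:\bigcup_{i\ge1}\mathcal{W}^i\rightrightarrows\mathcal{P}(\mathcal{W})$ with closed nonempty values are given. At the start of iteration $j\ge1$ a dataset $\widehat{\mathcal{W}}^{j-1}$ of $N_{j-1}$ i.i.d. samples of $w$ drawn from $\mathbb{P}$ is available, $\mathcal{D}^{j-1}:=\mathbb{D}(\widehat{\mathcal{W}}^{j-1})$, and it is a standing assumption that $\mathbb{P}^{|\widehat{\mathcal{W}}^{j-1}|}(\mathbb{P}\in\mathcal{D}^{j-1})\ge\zeta$, where $\mathbb{P}^{|\widehat{\mathcal{W}}^{j-1}|}$ is the probability over the draw of the dataset. **Trajectories and cost-to-go.** The trajectory of iteration $j$ is $\mathsf{x}^j=[x_0^j,x_1^j,\dots]$, $\mathsf{u}^j=[u_0^j,u_1^j,\dots]$, with $x_0^j=x_S$. If $x_F$ is reached at a finite time $T_j$, the state remains at $x_F$ with zero input for $t\ge T_j$. The trajectories of all iterations preceding the one under consideration are assumed to have finite length $T_i\in\mathbb{N}_{\ge1}$ (reaching $x_F$ at time $T_i$); for the iteration $j$ under consideration, the routine $\mathtt{DR\_MPC}$ may run forever, in which case its trajectory is the resulting infinite sequence. The cost-to-go is $J^j_{(t:\infty)}:=\sum_{k=t}^\infty r(x_k^j,u_k^j)$. **Sampled safe sets.** A sampled safe set $\overline{\mathcal{S}}$ is a finite set of triples (trajectory index, state, cost-to-go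 value). $\Pi_{\mathrm{state}}(\overline{\mathcal{S}})$ is the set of states appearing in $\overline{\mathcal{S}}$. The minimum cost-to-go $\overline{Q}$ of $\overline{\mathcal{S}}$ is $\overline{Q}(x)=\min\{J:(i,x,J)\in\overline{\mathcal{S}}\text{ for some }i\}$ if $x\in\Pi_{\mathrm{state}}(\overline{\mathcal{S}})$ and $+\infty$ otherwise. **Initialization.** $\mathcal{S}^0=\{(0,x_t^0,J^0_{(t:\infty)})\}_{t=0}^{T_0}$ comes from a finite-length trajectory $\mathsf{x}^0=[x_0^0,\dots,x_{T_0}^0]$ with controls $\mathsf{u}^0=[u_0^0,\dots,u_{T_0-1}^0]$ in $\mathcal{U}$ satisfying the system dynamics, $x_0^0=x_S$, $x_{T_0}^0=x_F$ (remaining at $x_F$ with zero input afterwards), which is robustly safe: $x\in\mathcal{X}$ and $g(x,w)\le\delta$ for all $w\in\mathcal{W}$ and all $x\in\Pi_{\mathrm{state}}(\mathcal{S}^0)$. Set $\mathcal{I}^0=\{0\}$. **Finite-horizon problem.** Let $K\in\mathbb{N}_{\ge1}$. For a state $x$, sampled safe set $\overline{\mathcal{S}}$ with minimum cost-to-go $\overline{Q}$, and ambiguity set $\overline{\mathcal{D}}$, $\mathcal{J}_{(\overline{\mathcal{S}},\overline{\mathcal{D}})}(x)$ is the optimal value of: minimize $\sum_{k=0}^{K-1}r(x_k,u_k)+\overline{Q}(x_K)$ over $(x_0,\dots,x_K)$, $(u_0,\dots,u_{K-1})$ subject to $x_0=x$, $x_K\in\Pi_{\mathrm{state}}(\overline{\mathcal{S}})$,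 and for all $k\in\{0,\dots,K-1\}$: $x_{k+1}=f(x_k,u_k)$, $x_k\in\mathcal{X}$, $u_k\in\mathcal{U}$, $\sup_{\mu\in\overline{\mathcal{D}}}\operatorname{CVaR}_\beta^\mu[g(x_k,w)]\le\delta$. Whenever feasible, the minimum is taken to be attained. **DR-RC-Iterative-MPC.** For $j=1,2,\dots$: (1) Generate $(\mathsf{x}^j,\mathsf{u}^j)$ by the routine $\mathtt{DR\_MPC}(\mathcal{S}^{j-1},\mathcal{D}^{j-1})$: start from $x_0^j=x_S$; at each $t$ while $x_t^j\ne x_F$, solve the finite-horizon problem with $x=x_t^j$, $\overline{\mathcal{S}}=\mathcal{S}^{j-1}$, $\overline{\mathcal{D}}=\mathcal{D}^{j-1}$, let $u_t^j$ be the first element of an optimal input sequence, and set $x_{t+1}^j=f(x_t^j,u_t^j)$. (2) Append $T_j$ new samples (one per time-step) to $\widehat{\mathcal{W}}^{j-1}$ to obtain $\widehat{\mathcal{W}}^j$ (so $N_j=N_{j-1}+T_j$), and set $\mathcal{D}^j=\mathbb{D}(\widehat{\mathcal{W}}^j)$. (3) Let $\mathcal{S}'=\mathcal{S}^{j-1}\cup\{(j,x_t^j,J^j_{(t:\infty)})\}_{t=1}^{T_j}$; let $\mathcal{UI}^j$ be the set of indices $i\in\mathcal{I}^{j-1}\cup\{j\}$ for which there is $(i,x,J)\in\mathcal{S}'$ with $\sup_{\mu\in\mathcal{D}^j}\operatorname{CVaR}_\beta^\mu[g(x,w)]>\delta$; set $\mathcal{I}^j=(\mathcal{I}^{j-1}\cup\{j\})\setminus\mathcal{UI}^j$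 and $\mathcal{S}^j=\{(i,x,J)\in\mathcal{S}':i\in\mathcal{I}^j\}$. *)

theory Defs
  imports "HOL-Probability.Probability"
begin

section \<open>Distributions on a compact support, and risk\<close>

text \<open>
  A distribution supported on \<open>W\<close> is a Borel probability measure whose underlying space is \<open>W\<close>
  itself, so that functions which are only known to be continuous on \<open>W\<close> are measurable.
\<close>

definition distributions_on :: "'w::topological_space set \<Rightarrow> 'w measure set" where
  "distributions_on W = {\<mu>. prob_space \<mu> \<and> sets \<mu> = sets (restrict_space borel W)}"

text \<open>
  Closedness of sets of distributions refers to the topology of weak convergence: the coarsest one
  making \<open>\<mu> \<mapsto> \<integral> h d\<mu>\<close> continuous for all continuous \<open>h\<close> (bounded, as \<open>W\<close> is compact).
\<close>

definition weak_topology :: "'w::topological_space set \<Rightarrow> 'w measure topology" where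
  "weak_topology W = topology_generated_by
     {{\<mu> \<in> distributions_on W. (\<integral>w. h w \<partial>\<mu>) \<in> V} |
        (h :: 'w \<Rightarrow> real) V. continuous_on W h \<and> open V}"

definition CVaR :: "real \<Rightarrow> 'w measure \<Rightarrow> ('w \<Rightarrow> real) \<Rightarrow> real" where
  "CVaR \<beta> \<mu> Z = (INF t. t + inverse \<beta> * (\<integral>w. max (Z w - t) 0 \<partial>\<mu>))"

text \<open>
  For \<open>x \<in> X\<close> the values \<open>CVaR \<beta> \<mu> (g x)\<close> lie between the bounds of \<open>g x\<close> on the compact set \<open>W\<close>,
  so the real-valued infimum above and supremum below are genuine.
\<close>

definition worst_case_CVaR ::
  "real \<Rightarrow> ('x \<Rightarrow> 'w \<Rightarrow> real) \<Rightarrow> 'w measure set \<Rightarrow> 'x \<Rightarrow> real" where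
  "worst_case_CVaR \<beta> g D x = (SUP \<mu>\<in>D. CVaR \<beta> \<mu> (g x))"


section \<open>Trajectories and sampled safe sets\<close>

text \<open>
  Trajectories are infinite sequences of states and inputs; those of finite length rest at the
  target with zero input. The real-valued series is used only for such trajectories, where all but
  finitely many terms vanish.
\<close>

definition cost_to_go ::
  "('x \<Rightarrow> 'u \<Rightarrow> real) \<Rightarrow> (nat \<Rightarrow> 'x) \<Rightarrow> (nat \<Rightarrow> 'u) \<Rightarrow> nat \<Rightarrow> real" where
  "cost_to_go r x u t = (\<Sum>k. r (x (t + k)) (u (t + k)))"

definition robustly_safe_trajectory ::
  "('x \<Rightarrow> 'u \<Rightarrow> 'x) \<Rightarrow> 'x set \<Rightarrow> 'u::zero set \<Rightarrow> 'x \<Rightarrow> 'x \<Rightarrow> 'w set \<Rightarrow> ('x \<Rightarrow> 'w \<Rightarrow> real) \<Rightarrow> real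
    \<Rightarrow> (nat \<Rightarrow> 'x) \<Rightarrow> (nat \<Rightarrow> 'u) \<Rightarrow> nat \<Rightarrow> bool" where
  "robustly_safe_trajectory f X U xS xF W g \<delta> x u T \<longleftrightarrow>
     1 \<le> T \<and> x 0 = xS \<and> x T = xF \<and>
     (\<forall>t<T. u t \<in> U \<and> x (Suc t) = f (x t) (u t)) \<and>
     (\<forall>t\<ge>T. x t = xF \<and> u t = 0) \<and>
     (\<forall>t\<le>T. x t \<in> X \<and> (\<forall>w\<in>W. g (x t) w \<le> \<delta>))"

text \<open>
  If a trajectory starts at the target, its length is taken to be 1: lengths are at least 1.
\<close>

definition has_finite_length :: "'x \<Rightarrow> (nat \<Rightarrow> 'x) \<Rightarrow> nat \<Rightarrow> bool" where
  "has_finite_length xF x T \<longleftrightarrow> 1 \<le> T \<and> x T = xF \<and> (\<forall>t. 1 \<le> t \<and> t < T \<longrightarrow> x t \<noteq> xF)"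

type_synonym 'x safe_set = "(nat \<times> 'x \<times> real) set"

definition safe_states :: "'x safe_set \<Rightarrow> 'x set" where
  "safe_states S = {x. \<exists>i J. (i, x, J) \<in> S}"

definition min_cost_to_go :: "'x safe_set \<Rightarrow> 'x \<Rightarrow> ereal" where
  "min_cost_to_go S x =
     (if x \<in> safe_states S then ereal (Min {J. \<exists>i. (i, x, J) \<in> S}) else \<infinity>)"


section \<open>Finite-horizon problem\<close>

text \<open>
  Decision variables are pairs of sequences \<open>(y, v)\<close>, of which only \<open>y 0, \<dots>, y K\<close> and
  \<open>v 0, \<dots>, v (K - 1)\<close> matter.
\<close>

definition fhp_feasible ::
  "('x \<Rightarrow> 'u \<Rightarrow> 'x) \<Rightarrow> 'x set \<Rightarrow> 'u set \<Rightarrow> ('x \<Rightarrow> 'w \<Rightarrow> real) \<Rightarrow> real \<Rightarrow> real \<Rightarrow> nat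
    \<Rightarrow> 'x safe_set \<Rightarrow> 'w measure set \<Rightarrow> 'x \<Rightarrow> ((nat \<Rightarrow> 'x) \<times> (nat \<Rightarrow> 'u)) set" where
  "fhp_feasible f X U g \<delta> \<beta> K S D x =
     {(y, v). y 0 = x \<and> y K \<in> safe_states S \<and>
        (\<forall>k<K. y (Suc k) = f (y k) (v k) \<and> y k \<in> X \<and> v k \<in> U \<and>
               worst_case_CVaR \<beta> g D (y k) \<le> \<delta>)}"

definition fhp_objective ::
  "('x \<Rightarrow> 'u \<Rightarrow> real) \<Rightarrow> nat \<Rightarrow> 'x safe_set \<Rightarrow> (nat \<Rightarrow> 'x) \<times> (nat \<Rightarrow> 'u) \<Rightarrow> ereal" where
  "fhp_objective r K S = (\<lambda>(y, v). ereal (\<Sum>k<K. r (y k) (v k)) + min_cost_to_go S (y K))"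

definition fhp_value ::
  "('x \<Rightarrow> 'u \<Rightarrow> 'x) \<Rightarrow> 'x set \<Rightarrow> 'u set \<Rightarrow> ('x \<Rightarrow> 'u \<Rightarrow> real) \<Rightarrow> ('x \<Rightarrow> 'w \<Rightarrow> real) \<Rightarrow> real \<Rightarrow> real
    \<Rightarrow> nat \<Rightarrow> 'x safe_set \<Rightarrow> 'w measure set \<Rightarrow> 'x \<Rightarrow> ereal" where
  "fhp_value f X U r g \<delta> \<beta> K S D x =
     (INF p\<in>fhp_feasible f X U g \<delta> \<beta> K S D x. fhp_objective r K S p)"

definition fhp_solutions ::
  "('x \<Rightarrow> 'u \<Rightarrow> 'x) \<Rightarrow> 'x set \<Rightarrow> 'u set \<Rightarrow> ('x \<Rightarrow> 'u \<Rightarrow> real) \<Rightarrow> ('x \<Rightarrow> 'w \<Rightarrow> real) \<Rightarrow> real \<Rightarrow> real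
    \<Rightarrow> nat \<Rightarrow> 'x safe_set \<Rightarrow> 'w measure set \<Rightarrow> 'x \<Rightarrow> ((nat \<Rightarrow> 'x) \<times> (nat \<Rightarrow> 'u)) set" where
  "fhp_solutions f X U r g \<delta> \<beta> K S D x =
     {p \<in> fhp_feasible f X U g \<delta> \<beta> K S D x.
        fhp_objective r K S p = fhp_value f X U r g \<delta> \<beta> K S D x}"


section \<open>The iterative scheme\<close>

text \<open>
  The routine need not choose the same optimal solution every time it visits a state, hence a
  relation. Solvability of the problems met along the way is deliberately not part of the relation:
  a step without an optimal solution is left unconstrained, so recursive feasibility has to be
  proved and is not assumed.
\<close>

definition DR_MPC ::
  "('x \<Rightarrow> 'u::zero \<Rightarrow> 'x) \<Rightarrow> 'x set \<Rightarrow> 'u set \<Rightarrow> 'x \<Rightarrow> 'x \<Rightarrow> ('x \<Rightarrow> 'u \<Rightarrow> real) \<Rightarrow> ('x \<Rightarrow> 'w \<Rightarrow> real)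
    \<Rightarrow> real \<Rightarrow> real \<Rightarrow> nat \<Rightarrow> 'x safe_set \<Rightarrow> 'w measure set \<Rightarrow> (nat \<Rightarrow> 'x) \<Rightarrow> (nat \<Rightarrow> 'u) \<Rightarrow> bool" where
  "DR_MPC f X U xS xF r g \<delta> \<beta> K S D x u \<longleftrightarrow>
     x 0 = xS \<and>
     (\<forall>t. x t = xF \<longrightarrow> u t = 0 \<and> x (Suc t) = xF) \<and>
     (\<forall>t. x t \<noteq> xF \<and> fhp_solutions f X U r g \<delta> \<beta> K S D (x t) \<noteq> {} \<longrightarrow>
        (\<exists>(y, v) \<in> fhp_solutions f X U r g \<delta> \<beta> K S D (x t).
           u t = v 0 \<and> x (Suc t) = f (x t) (u t)))"

text \<open>
  The pair \<open>(\<I>\<^sup>j, \<S>\<^sup>j)\<close> of retained trajectory indices and sampled safe set after iteration \<open>j\<close>, where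
  \<open>x i\<close>, \<open>u i\<close>, \<open>T i\<close> are the states, inputs and length of trajectory \<open>i\<close> and \<open>D i\<close> is the
  ambiguity set available after iteration \<open>i\<close>.
\<close>

primrec indices_and_safe_set ::
  "('x \<Rightarrow> 'u \<Rightarrow> real) \<Rightarrow> ('x \<Rightarrow> 'w \<Rightarrow> real) \<Rightarrow> real \<Rightarrow> real \<Rightarrow> (nat \<Rightarrow> 'w measure set)
    \<Rightarrow> (nat \<Rightarrow> nat \<Rightarrow> 'x) \<Rightarrow> (nat \<Rightarrow> nat \<Rightarrow> 'u) \<Rightarrow> (nat \<Rightarrow> nat) \<Rightarrow> nat \<Rightarrow> nat set \<times> 'x safe_set" where
  "indices_and_safe_set r g \<delta> \<beta> D x u T 0 =
     ({0}, {(0, x 0 t, cost_to_go r (x 0) (u 0) t) | t. t \<le> T 0})"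
| "indices_and_safe_set r g \<delta> \<beta> D x u T (Suc i) =
     (let (I, S) = indices_and_safe_set r g \<delta> \<beta> D x u T i;
          j = Suc i;
          S' = S \<union> {(j, x j t, cost_to_go r (x j) (u j) t) | t. 1 \<le> t \<and> t \<le> T j};
          UI = {k \<in> I \<union> {j}. \<exists>z J. (k, z, J) \<in> S' \<and> worst_case_CVaR \<beta> g (D j) z > \<delta>};
          I' = (I \<union> {j}) - UI
      in (I', {(k, z, J) \<in> S'. k \<in> I'}))"

definition sampled_safe_set ::
  "('x \<Rightarrow> 'u \<Rightarrow> real) \<Rightarrow> ('x \<Rightarrow> 'w \<Rightarrow> real) \<Rightarrow> real \<Rightarrow> real \<Rightarrow> (nat \<Rightarrow> 'w measure set)
    \<Rightarrow> (nat \<Rightarrow> nat \<Rightarrow> 'x) \<Rightarrow> (nat \<Rightarrow> nat \<Rightarrow> 'u) \<Rightarrow> (nat \<Rightarrow> nat) \<Rightarrow> nat \<Rightarrow> 'x safe_set" where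
  "sampled_safe_set r g \<delta> \<beta> D x u T j = snd (indices_and_safe_set r g \<delta> \<beta> D x u T j)"

end

theory Submission
  imports Defs
begin

text \<open>
  The argument is the classical one of learning model predictive control: the optimal value of the
  finite-horizon problem is a Lyapunov function along the closed loop.

  What makes it work is a property of the sampled safe sets, called \<open>sustainable\<close> below: from every
  stored triple some admissible input leads to another stored triple whose stored cost is lower by
  at least the stage cost paid. An optimal plan ends in the safe set, so after dropping its first
  step it can be extended by one such input. The result is a feasible plan at the next state
  (recursive feasibility) and shows that the value drops by at least the stage cost just paid
  (\<open>MPC_step\<close>). The value being nonnegative, the stage costs along the run have bounded partial
  sums, hence tend to zero; compactness of \<open>X \<times> U\<close> and positivity of the cost away from the target
  equilibrium then force the states to converge (\<open>tendsto_of_cost_tendsto_zero\<close>).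

  Sustainability of all safe sets is proved by induction over the iterations
  (\<open>sampled_safe_set_sustainable\<close>). Trajectories are stored or discarded as a whole, and a
  trajectory that has reached the target may rest there for free, so the successor of a stored state
  along its own trajectory is always stored. Stored states satisfy the current risk constraint,
  because the scheme discards the trajectories that do not. The initial trajectory is never
  discarded: on its states \<open>g \<le> \<delta>\<close> holds on all of \<open>W\<close>, hence the CVaR is at most \<open>\<delta>\<close> under every
  distribution on \<open>W\<close> (\<open>worst_case_CVaR_le\<close>). It provides a feasible plan at \<open>xS\<close>, which starts the
  recursion in each iteration.
\<close>

section \<open>Bounding the risk by a bound on the random variable\<close>

text \<open>
  The choice \<open>t = b\<close> makes the excess vanish. Since the infimum is taken in the reals, it must also
  be known to be bounded below; this is where \<open>\<beta> \<le> 1\<close> and integrability enter, giving the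
  expectation as a lower bound.
\<close>

lemma CVaR_le:
  assumes "prob_space \<mu>" and int: "integrable \<mu> Z" and le: "\<And>w. w \<in> space \<mu> \<Longrightarrow> Z w \<le> b"
    and \<beta>: "0 < \<beta>" "\<beta> \<le> 1"
  shows "CVaR \<beta> \<mu> Z \<le> b"
proof -
  interpret prob_space \<mu> by fact
  define h where "h t = t + inverse \<beta> * (\<integral>w. max (Z w - t) 0 \<partial>\<mu>)" for t
  have "integral\<^sup>L \<mu> Z \<le> h t" for t
  proof -
    have pos: "0 \<le> (\<integral>w. max (Z w - t) 0 \<partial>\<mu>)"
      by (rule integral_nonneg_AE) auto
    have "integral\<^sup>L \<mu> Z - t = (\<integral>w. Z w - t \<partial>\<mu>)"
      using int by (simp add: prob_space)
    also have "\<dots> \<le> (\<integral>w. max (Z w - t) 0 \<partial>\<mu>)"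
      using int by (intro integral_mono integrable_max) auto
    also have "\<dots> \<le> inverse \<beta> * (\<integral>w. max (Z w - t) 0 \<partial>\<mu>)"
      using mult_right_mono[of 1 "inverse \<beta>", OF _ pos] \<beta> by (simp add: one_le_inverse)
    finally show ?thesis by (simp add: h_def)
  qed
  then have "bdd_below (range h)" by (intro bdd_belowI2)
  then have "(INF t. h t) \<le> h b" by (rule cINF_lower) simp
  moreover have "(\<integral>w. max (Z w - b) 0 \<partial>\<mu>) = (\<integral>w. 0 \<partial>\<mu>)"
    using le by (intro Bochner_Integration.integral_cong) (auto simp: max_def)
  ultimately show ?thesis by (simp add: CVaR_def h_def)
qed

lemma integrable_distributions_on:
  fixes h :: "'w::t2_space \<Rightarrow> real"
  assumes "compact W" "\<mu> \<in> distributions_on W" "continuous_on W h"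
  shows "integrable \<mu> h"
proof -
  interpret prob_space \<mu> using assms(2) by (simp add: distributions_on_def)
  have sets: "sets \<mu> = sets (restrict_space borel W)"
    using assms(2) by (simp add: distributions_on_def)
  have space: "space \<mu> = W"
    using sets_eq_imp_space_eq[OF sets] by (simp add: space_restrict_space)
  have "bounded (h ` W)"
    using assms compact_continuous_image compact_imp_bounded by blast
  then obtain B where "\<And>w. w \<in> W \<Longrightarrow> norm (h w) \<le> B"
    by (auto simp: bounded_iff)
  moreover have "h \<in> borel_measurable \<mu>"
    using borel_measurable_continuous_on_restrict[OF assms(3)] measurable_cong_sets[OF sets refl]
    by blast
  ultimately show ?thesis
    using space by (intro integrable_const_bound[of _ B]) auto
qed

lemma worst_case_CVaR_le:
  assumes "compact W" "D \<noteq> {}" "D \<subseteq> distributions_on (W :: 'w::t2_space set)"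
    and "continuous_on W (g z)" "\<And>w. w \<in> W \<Longrightarrow> g z w \<le> b" "0 < \<beta>" "\<beta> \<le> 1"
  shows "worst_case_CVaR \<beta> g D z \<le> b"
  unfolding worst_case_CVaR_def
proof (rule cSUP_least)
  fix \<mu> assume "\<mu> \<in> D"
  then have \<mu>: "\<mu> \<in> distributions_on W" using assms by blast
  then have sets: "sets \<mu> = sets (restrict_space borel W)" by (simp add: distributions_on_def)
  have "space \<mu> = W"
    using sets_eq_imp_space_eq[OF sets] by (simp add: space_restrict_space)
  with \<mu> assms show "CVaR \<beta> \<mu> (g z) \<le> b"
    by (intro CVaR_le integrable_distributions_on[of W]) (auto simp: distributions_on_def)
qed (use assms in simp)


section \<open>Vanishing stage cost forces convergence\<close>

text \<open>
  Away from any neighbourhood of the target, the cost has a positive minimum by compactness.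
\<close>

lemma tendsto_of_cost_tendsto_zero:
  fixes x :: "nat \<Rightarrow> 'x::metric_space" and u :: "nat \<Rightarrow> 'u::metric_space"
  assumes "compact X" "compact U"
    and cont: "continuous_on (X \<times> U) (\<lambda>(y, v). r y v)"
    and pos: "\<forall>(y, v) \<in> X \<times> U - {(a, b)}. (0::real) < r y v"
    and inX: "\<And>t. x t \<in> X" and inU: "\<And>t. u t \<in> U"
    and lim: "(\<lambda>t. r (x t) (u t)) \<longlonglongrightarrow> 0"
  shows "x \<longlonglongrightarrow> a"
proof (rule tendstoI)
  fix e :: real assume e: "0 < e"
  define C where "C = {p \<in> X \<times> U. e \<le> dist (fst p) a}"
  have "C = (X \<times> U) \<inter> {p. e \<le> dist (fst p) a}" by (auto simp: C_def)
  moreover have "closed {p :: 'x \<times> 'u. e \<le> dist (fst p) a}"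
    by (intro closed_Collect_le continuous_intros)
  ultimately have C: "compact C"
    using assms by (simp add: compact_Int_closed compact_Times)
  show "\<forall>\<^sub>F t in sequentially. dist (x t) a < e"
  proof (cases "C = {}")
    case True
    have "dist (x t) a < e" for t
    proof -
      have "(x t, u t) \<notin> C" using True by simp
      then show ?thesis using inX inU by (auto simp: C_def)
    qed
    then show ?thesis by simp
  next
    case False
    have "continuous_on C (\<lambda>(y, v). r y v)"
      using cont by (rule continuous_on_subset) (auto simp: C_def)
    then obtain p where p: "p \<in> C" "\<forall>q\<in>C. (\<lambda>(y, v). r y v) p \<le> (\<lambda>(y, v). r y v) q"
      using continuous_attains_inf[OF C False] by blast
    have "0 < (\<lambda>(y, v). r y v) p"
      using p(1) pos e by (fastforce simp: C_def)
    then have "\<forall>\<^sub>F t in sequentially. r (x t) (u t) < (\<lambda>(y, v). r y v) p"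
      using lim by (rule order_tendstoD(2)[rotated])
    then show ?thesis
    proof (rule eventually_mono)
      fix t assume "r (x t) (u t) < (\<lambda>(y, v). r y v) p"
      then have "(x t, u t) \<notin> C" using p(2) by fastforce
      then show "dist (x t) a < e" using inX inU by (auto simp: C_def)
    qed
  qed
qed


section \<open>The value function decreases along the closed loop\<close>

lemma min_cost_to_go_le:
  assumes "finite S" "(i, z, J) \<in> S"
  shows "min_cost_to_go S z \<le> ereal J"
proof -
  have "{J. \<exists>i. (i, z, J) \<in> S} \<subseteq> (\<lambda>(i, z, J). J) ` S" by force
  then have "finite {J. \<exists>i. (i, z, J) \<in> S}"
    using assms(1) finite_surj by blast
  then show ?thesis using assms by (auto simp: min_cost_to_go_def safe_states_def intro!: Min_le)
qed

lemma min_cost_to_go_attained: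
  assumes "finite S" "z \<in> safe_states S"
  obtains i J where "(i, z, J) \<in> S" "min_cost_to_go S z = ereal J"
proof -
  have "{J. \<exists>i. (i, z, J) \<in> S} \<subseteq> (\<lambda>(i, z, J). J) ` S" by force
  then have "finite {J. \<exists>i. (i, z, J) \<in> S}"
    using assms(1) finite_surj by blast
  moreover have "{J. \<exists>i. (i, z, J) \<in> S} \<noteq> {}"
    using assms(2) by (auto simp: safe_states_def)
  ultimately have "Min {J. \<exists>i. (i, z, J) \<in> S} \<in> {J. \<exists>i. (i, z, J) \<in> S}"
    by (rule Min_in)
  then show ?thesis using that assms(2) by (auto simp: min_cost_to_go_def)
qed

locale mpc_problem =
  fixes f :: "'x \<Rightarrow> 'u::zero \<Rightarrow> 'x" and X :: "'x set" and U :: "'u set" and xF :: 'x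
    and r :: "'x \<Rightarrow> 'u \<Rightarrow> real" and g :: "'x \<Rightarrow> 'w \<Rightarrow> real" and \<delta> \<beta> :: real and K :: nat
  assumes zero_in_U: "0 \<in> U" and xF_in_X: "xF \<in> X" and xF_equilibrium: "f xF 0 = xF"
    and r_nonneg: "\<And>y v. y \<in> X \<Longrightarrow> v \<in> U \<Longrightarrow> 0 \<le> r y v"
    and r_zero: "r xF 0 = 0" and K_ge_1: "1 \<le> K"
begin

abbreviation "feasible \<equiv> fhp_feasible f X U g \<delta> \<beta> K"
abbreviation "solutions \<equiv> fhp_solutions f X U r g \<delta> \<beta> K"
abbreviation "val \<equiv> fhp_value f X U r g \<delta> \<beta> K"

text \<open>
  The finite analogue of a control invariant set on which the stored costs are a control Lyapunov
  function. The successor keeps the trajectory index, so that the property survives the removal of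
  all triples with a given index.
\<close>

definition sustainable :: "'x safe_set \<Rightarrow> 'w measure set \<Rightarrow> bool" where
  "sustainable S D \<longleftrightarrow> finite S \<and>
     (\<forall>i z J. (i, z, J) \<in> S \<longrightarrow>
        z \<in> X \<and> worst_case_CVaR \<beta> g D z \<le> \<delta> \<and> 0 \<le> J \<and>
        (\<exists>v\<in>U. \<exists>J'. (i, f z v, J') \<in> S \<and> r z v + J' \<le> J))"

lemma sustainableD:
  assumes "sustainable S D" "(i, z, J) \<in> S"
  shows "z \<in> X" "worst_case_CVaR \<beta> g D z \<le> \<delta>" "0 \<le> J"
    and "\<exists>v\<in>U. \<exists>J'. (i, f z v, J') \<in> S \<and> r z v + J' \<le> J"
  using assms unfolding sustainable_def by blast+

lemma feasible_if_safe_state: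
  assumes S: "sustainable S D" and z: "z \<in> safe_states S"
  shows "feasible S D z \<noteq> {}"
proof -
  have "\<forall>y\<in>safe_states S. \<exists>v. v \<in> U \<and> f y v \<in> safe_states S"
    using sustainableD(4)[OF S] unfolding safe_states_def by blast
  then obtain h where h: "\<And>y. y \<in> safe_states S \<Longrightarrow> h y \<in> U \<and> f y (h y) \<in> safe_states S"
    by metis
  define y where "y k = ((\<lambda>y. f y (h y)) ^^ k) z" for k
  have safe: "y k \<in> safe_states S" for k
    by (induction k) (auto simp: y_def z h)
  have "y k \<in> X \<and> worst_case_CVaR \<beta> g D (y k) \<le> \<delta>" for k
    using safe[of k] sustainableD(1,2)[OF S] unfolding safe_states_def by blast
  then have "(y, \<lambda>k. h (y k)) \<in> feasible S D z"
    using safe h by (auto simp: fhp_feasible_def) (auto simp: y_def)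
  then show ?thesis by blast
qed

lemma feasible_objective:
  assumes S: "sustainable S D" and p: "(y, v) \<in> feasible S D z"
  obtains i J where "(i, y K, J) \<in> S"
    and "fhp_objective r K S (y, v) = ereal ((\<Sum>k<K. r (y k) (v k)) + J)"
    and "0 \<le> (\<Sum>k<K. r (y k) (v k)) + J"
proof -
  have "finite S" "y K \<in> safe_states S"
    using S p by (auto simp: sustainable_def fhp_feasible_def)
  then obtain i J where J: "(i, y K, J) \<in> S" "min_cost_to_go S (y K) = ereal J"
    by (rule min_cost_to_go_attained)
  have "0 \<le> (\<Sum>k<K. r (y k) (v k))"
    using p r_nonneg by (intro sum_nonneg) (auto simp: fhp_feasible_def)
  then show ?thesis
    using that[OF J(1)] J sustainableD(3)[OF S J(1)] by (simp add: fhp_objective_def)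
qed

lemma val_nonneg:
  assumes "sustainable S D"
  shows "0 \<le> val S D z"
  unfolding fhp_value_def
proof (rule INF_greatest)
  fix p assume "p \<in> feasible S D z"
  then show "0 \<le> fhp_objective r K S p"
    using feasible_objective[OF assms] by (cases p) (metis ereal_less_eq(5))
qed

lemma val_less_top:
  assumes "sustainable S D" "feasible S D z \<noteq> {}"
  shows "val S D z < \<infinity>"
proof -
  obtain y v where p: "(y, v) \<in> feasible S D z" using assms(2) by auto
  obtain c where "fhp_objective r K S (y, v) = ereal c"
    using feasible_objective[OF assms(1) p] by metis
  moreover have "val S D z \<le> fhp_objective r K S (y, v)"
    unfolding fhp_value_def by (rule INF_lower[OF p])
  ultimately show ?thesis by (auto simp: less_top[symmetric])
qed

text \<open>
  The shifted plan: the first step is dropped, and the terminal state, a stored one, is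
  continued by the input that sustainability provides. The new plan costs at most the old one minus
  the first stage cost.
\<close>

lemma shifted_plan:
  assumes S: "sustainable S D" and p: "(y, v) \<in> feasible S D z"
  shows "feasible S D (y 1) \<noteq> {}"
    and "val S D (y 1) + ereal (r (y 0) (v 0)) \<le> fhp_objective r K S (y, v)"
proof -
  obtain i J where J: "(i, y K, J) \<in> S"
    and obj: "fhp_objective r K S (y, v) = ereal ((\<Sum>k<K. r (y k) (v k)) + J)"
    using feasible_objective[OF S p] by metis
  obtain a J' where a: "a \<in> U" "(i, f (y K) a, J') \<in> S" "r (y K) a + J' \<le> J"
    using sustainableD(4)[OF S J] by blast
  define y' where "y' k = (if k < K then y (Suc k) else f (y K) a)" for k
  define v' where "v' k = (if Suc k < K then v (Suc k) else a)" for k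
  have feas: "\<And>k. k < K \<Longrightarrow>
      y (Suc k) = f (y k) (v k) \<and> y k \<in> X \<and> v k \<in> U \<and> worst_case_CVaR \<beta> g D (y k) \<le> \<delta>"
    using p by (auto simp: fhp_feasible_def)
  have "y' (Suc k) = f (y' k) (v' k) \<and> y' k \<in> X \<and> v' k \<in> U \<and>
      worst_case_CVaR \<beta> g D (y' k) \<le> \<delta>" if "k < K" for k
  proof (cases "Suc k < K")
    case True
    then show ?thesis using feas[of "Suc k"] by (simp add: y'_def v'_def)
  next
    case False
    with that have "Suc k = K" by simp
    then show ?thesis
      using that a(1) sustainableD(1,2)[OF S J] by (auto simp: y'_def v'_def)
  qed
  moreover have "y' K \<in> safe_states S" "y' 0 = y 1"
    using a(2) K_ge_1 by (auto simp: y'_def safe_states_def)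
  ultimately have p': "(y', v') \<in> feasible S D (y 1)"
    by (simp add: fhp_feasible_def)
  then show "feasible S D (y 1) \<noteq> {}" by blast
  obtain L where L: "K = Suc L" using K_ge_1 by (cases K) auto
  have "(\<Sum>k<K. r (y' k) (v' k)) = (\<Sum>k<L. r (y (Suc k)) (v (Suc k))) + r (y K) a"
    by (simp add: L y'_def v'_def)
  moreover have "(\<Sum>k<K. r (y k) (v k)) = r (y 0) (v 0) + (\<Sum>k<L. r (y (Suc k)) (v (Suc k)))"
    unfolding L by (rule sum.lessThan_Suc_shift)
  ultimately have costs: "(\<Sum>k<K. r (y' k) (v' k)) + J' + r (y 0) (v 0) \<le> (\<Sum>k<K. r (y k) (v k)) + J"
    using a(3) by simp
  have "val S D (y 1) \<le> fhp_objective r K S (y', v')"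
    unfolding fhp_value_def by (rule INF_lower[OF p'])
  also have "\<dots> \<le> ereal (\<Sum>k<K. r (y' k) (v' k)) + ereal J'"
    using min_cost_to_go_le[OF _ a(2)] S
    by (auto simp: fhp_objective_def sustainable_def y'_def simp del: plus_ereal.simps
        intro!: add_left_mono)
  finally have "val S D (y 1) + ereal (r (y 0) (v 0))
      \<le> ereal ((\<Sum>k<K. r (y' k) (v' k)) + J') + ereal (r (y 0) (v 0))"
    by (intro add_right_mono) simp
  also have "\<dots> \<le> fhp_objective r K S (y, v)"
    using costs by (simp add: obj)
  finally show "val S D (y 1) + ereal (r (y 0) (v 0)) \<le> fhp_objective r K S (y, v)" .
qed

lemma MPC_step:
  assumes S: "sustainable S D"
    and attained: "\<forall>y. feasible S D y \<noteq> {} \<longrightarrow> solutions S D y \<noteq> {}"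
    and run: "DR_MPC f X U xS xF r g \<delta> \<beta> K S D x u"
    and feas: "feasible S D (x t) \<noteq> {}"
  shows "x t \<in> X \<and> u t \<in> U \<and> x (Suc t) = f (x t) (u t)"
    and "feasible S D (x (Suc t)) \<noteq> {}"
    and "val S D (x (Suc t)) + ereal (r (x t) (u t)) \<le> val S D (x t)"
proof -
  have "(x t \<in> X \<and> u t \<in> U \<and> x (Suc t) = f (x t) (u t)) \<and> feasible S D (x (Suc t)) \<noteq> {} \<and>
      val S D (x (Suc t)) + ereal (r (x t) (u t)) \<le> val S D (x t)"
  proof (cases "x t = xF")
    case True
    moreover have "u t = 0" "x (Suc t) = xF" using run True by (auto simp: DR_MPC_def)
    ultimately show ?thesis
      using feas zero_in_U xF_in_X xF_equilibrium r_zero by (simp flip: zero_ereal_def)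
  next
    case False
    then have "\<exists>(y, v) \<in> solutions S D (x t). u t = v 0 \<and> x (Suc t) = f (x t) (u t)"
      using run attained feas unfolding DR_MPC_def by blast
    then obtain y v where yv: "(y, v) \<in> solutions S D (x t)"
      and next_state: "u t = v 0" "x (Suc t) = f (x t) (u t)"
      by blast
    have p: "(y, v) \<in> feasible S D (x t)"
      and opt: "fhp_objective r K S (y, v) = val S D (x t)"
      using yv by (auto simp: fhp_solutions_def)
    have "0 < K" using K_ge_1 by simp
    then have "y 0 = x t" "y 1 = f (y 0) (v 0)" "y 0 \<in> X" "v 0 \<in> U"
      using p unfolding fhp_feasible_def by auto
    then show ?thesis
      using next_state shifted_plan[OF S p] opt by simp
  qed
  then show "x t \<in> X \<and> u t \<in> U \<and> x (Suc t) = f (x t) (u t)"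
    "feasible S D (x (Suc t)) \<noteq> {}"
    "val S D (x (Suc t)) + ereal (r (x t) (u t)) \<le> val S D (x t)" by blast+
qed

context
  fixes S D xS x u
  assumes S: "sustainable S D" and xS: "xS \<in> safe_states S"
    and attained: "\<forall>y. feasible S D y \<noteq> {} \<longrightarrow> solutions S D y \<noteq> {}"
    and run: "DR_MPC f X U xS xF r g \<delta> \<beta> K S D x u"
begin

lemma MPC_run_feasible: "feasible S D (x t) \<noteq> {}"
proof (induction t)
  case 0
  then show ?case using feasible_if_safe_state[OF S xS] run by (simp add: DR_MPC_def)
next
  case (Suc t)
  then show ?case by (rule MPC_step(2)[OF S attained run])
qed

lemma MPC_run_admissible: "x t \<in> X" "u t \<in> U" "x (Suc t) = f (x t) (u t)"
  using MPC_step(1)[OF S attained run MPC_run_feasible] by blast+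

lemma MPC_run_cost_tendsto_zero: "(\<lambda>t. r (x t) (u t)) \<longlonglongrightarrow> 0"
proof -
  have telescope: "val S D (x n) + ereal (\<Sum>t<n. r (x t) (u t)) \<le> val S D (x 0)" for n
  proof (induction n)
    case (Suc n)
    have "val S D (x (Suc n)) + ereal (\<Sum>t<Suc n. r (x t) (u t))
        = (val S D (x (Suc n)) + ereal (r (x n) (u n))) + ereal (\<Sum>t<n. r (x t) (u t))"
      by (simp add: ac_simps flip: plus_ereal.simps(1))
    also have "\<dots> \<le> val S D (x n) + ereal (\<Sum>t<n. r (x t) (u t))"
      by (intro add_right_mono MPC_step(3)[OF S attained run MPC_run_feasible])
    finally show ?case using Suc by simp
  qed (simp flip: zero_ereal_def)
  obtain c where c: "val S D (x 0) = ereal c"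
    using val_nonneg[OF S] val_less_top[OF S MPC_run_feasible[of 0]]
    by (metis ereal_cases ereal_infty_less_eq(2) less_irrefl zero_ereal_def MInfty_neq_ereal(1))
  have "(\<Sum>t<n. r (x t) (u t)) \<le> c" for n
  proof -
    have "ereal (\<Sum>t<n. r (x t) (u t)) \<le> val S D (x n) + ereal (\<Sum>t<n. r (x t) (u t))"
      using add_right_mono[OF val_nonneg[OF S], of "ereal (\<Sum>t<n. r (x t) (u t))"] by simp
    also have "\<dots> \<le> ereal c" using telescope c by simp
    finally show ?thesis by simp
  qed
  then have "summable (\<lambda>t. r (x t) (u t))"
    by (intro summableI_nonneg_bounded) (use r_nonneg MPC_run_admissible in auto)
  then show ?thesis by (rule summable_LIMSEQ_zero)
qed

end


section \<open>The sampled safe sets are sustainable\<close>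

text \<open>
  What the initial trajectory and the closed-loop trajectories that have reached the target have in
  common. Risk is left out: it depends on the current ambiguity set, not on the trajectory alone.
\<close>

definition completed_trajectory :: "(nat \<Rightarrow> 'x) \<Rightarrow> (nat \<Rightarrow> 'u) \<Rightarrow> nat \<Rightarrow> bool" where
  "completed_trajectory x u T \<longleftrightarrow>
     (\<forall>t. x t \<in> X \<and> u t \<in> U \<and> x (Suc t) = f (x t) (u t)) \<and> (\<forall>t\<ge>T. x t = xF \<and> u t = 0)"

lemma completed_trajectory_cost_to_go:
  assumes c: "completed_trajectory x u T"
  shows "cost_to_go r x u t = r (x t) (u t) + cost_to_go r x u (Suc t)"
    and "0 \<le> cost_to_go r x u t"
    and "T \<le> t \<Longrightarrow> cost_to_go r x u t = 0"
proof -
  have sum: "summable (\<lambda>k. r (x (t + k)) (u (t + k)))" for t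
    using c by (intro summable_finite[of "{..<T}"]) (auto simp: completed_trajectory_def r_zero)
  show "cost_to_go r x u t = r (x t) (u t) + cost_to_go r x u (Suc t)"
    using suminf_split_head[OF sum[of t]] by (simp add: cost_to_go_def)
  show "0 \<le> cost_to_go r x u t"
    using c unfolding cost_to_go_def
    by (intro suminf_nonneg sum r_nonneg) (auto simp: completed_trajectory_def)
  show "cost_to_go r x u t = 0" if "T \<le> t"
    using c that by (simp add: cost_to_go_def completed_trajectory_def r_zero)
qed

text \<open>
  The last triple is its own successor: resting at the target costs nothing. This covers \<open>t = T\<close>.
\<close>

lemma completed_trajectory_successor:
  assumes c: "completed_trajectory x u T"
    and t: "m \<le> t" "t \<le> T"
  shows "\<exists>v\<in>U. \<exists>t'. m \<le> t' \<and> t' \<le> T \<and> f (x t) v = x t' \<and>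
      r (x t) v + cost_to_go r x u t' \<le> cost_to_go r x u t"
proof (cases "t = T")
  case True
  then have "x t = xF" "u t = 0" using c by (auto simp: completed_trajectory_def)
  then show ?thesis using True t zero_in_U
    by (intro bexI[of _ 0] exI[of _ t]) (auto simp: xF_equilibrium r_zero)
next
  case False
  then show ?thesis using c t completed_trajectory_cost_to_go(1)[OF c, of t]
    by (intro bexI[of _ "u t"] exI[of _ "Suc t"]) (auto simp: completed_trajectory_def)
qed

lemma MPC_run_completed:
  assumes "sustainable S D" "xS \<in> safe_states S"
    and "\<forall>y. feasible S D y \<noteq> {} \<longrightarrow> solutions S D y \<noteq> {}"
    and run: "DR_MPC f X U xS xF r g \<delta> \<beta> K S D x u"
    and T: "x T = xF"
  shows "completed_trajectory x u T"
proof -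
  have stay: "x t = xF \<Longrightarrow> u t = 0 \<and> x (Suc t) = xF" for t
    using run by (simp add: DR_MPC_def)
  have "x t = xF" if "T \<le> t" for t
    using that by (induction t rule: dec_induct) (auto simp: T stay)
  then show ?thesis
    using MPC_run_admissible[OF assms(1-4)] stay by (auto simp: completed_trajectory_def)
qed

text \<open>
  That the triples of index 0 come from trajectory 0 alone is part of the invariant because it shows
  that trajectory 0 survives the next update, which in turn keeps \<open>xS\<close> a safe state.
\<close>

lemma sampled_safe_set_sustainable:
  fixes x :: "nat \<Rightarrow> nat \<Rightarrow> 'x" and u :: "nat \<Rightarrow> nat \<Rightarrow> 'u" and T :: "nat \<Rightarrow> nat"
    and D :: "nat \<Rightarrow> 'w measure set"
  defines "S \<equiv> sampled_safe_set r g \<delta> \<beta> D x u T"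
  assumes init: "completed_trajectory (x 0) (u 0) (T 0)" "x 0 0 = xS"
    and risk0: "\<And>i t. t \<le> T 0 \<Longrightarrow> worst_case_CVaR \<beta> g (D i) (x 0 t) \<le> \<delta>"
    and attained: "\<And>i. i < n \<Longrightarrow> \<forall>y. feasible (S i) (D i) y \<noteq> {} \<longrightarrow> solutions (S i) (D i) y \<noteq> {}"
    and run: "\<And>i. i < n \<Longrightarrow> DR_MPC f X U xS xF r g \<delta> \<beta> K (S i) (D i) (x (Suc i)) (u (Suc i))"
    and finite_length: "\<And>i. i < n \<Longrightarrow> x (Suc i) (T (Suc i)) = xF"
  shows "sustainable (S n) (D n)" and "xS \<in> safe_states (S n)"
proof -
  define traj where "traj i m = {(i, x i t, cost_to_go r (x i) (u i) t) | t. m \<le> t \<and> t \<le> T i}" for i m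
  have finite_traj: "finite (traj i m)" for i m
    by (rule finite_surj[of "{..T i}" _ "\<lambda>t. (i, x i t, cost_to_go r (x i) (u i) t)"])
      (auto simp: traj_def)
  have traj_props: "k = i \<and> z \<in> X \<and> 0 \<le> J \<and> (\<exists>v\<in>U. \<exists>J'. (i, f z v, J') \<in> traj i m \<and> r z v + J' \<le> J)"
    if c: "completed_trajectory (x i) (u i) (T i)" and mem: "(k, z, J) \<in> traj i m" for i m k z J
  proof -
    obtain t where t: "m \<le> t" "t \<le> T i" "k = i" "z = x i t" "J = cost_to_go r (x i) (u i) t"
      using mem by (auto simp: traj_def)
    show ?thesis
      using completed_trajectory_successor[OF c t(1,2)] completed_trajectory_cost_to_go(2)[OF c, of t]
        c t by (fastforce simp: traj_def completed_trajectory_def)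
  qed
  define I where "I i = fst (indices_and_safe_set r g \<delta> \<beta> D x u T i)" for i
  have S_eq: "S i = snd (indices_and_safe_set r g \<delta> \<beta> D x u T i)" for i
    by (simp add: S_def sampled_safe_set_def)
  have "i \<le> n \<Longrightarrow> sustainable (S i) (D i) \<and> 0 \<in> I i \<and> traj 0 0 \<subseteq> S i \<and>
      (\<forall>z J. (0, z, J) \<in> S i \<longrightarrow> (0, z, J) \<in> traj 0 0)" for i
  proof (induction i)
    case 0
    have base: "0 \<in> I 0" "S 0 = traj 0 0"
      by (auto simp: I_def S_eq traj_def)
    have "worst_case_CVaR \<beta> g (D 0) z \<le> \<delta>" if "(k, z, J) \<in> traj 0 0" for k z J
      using that risk0 by (auto simp: traj_def)
    moreover have "z \<in> X \<and> 0 \<le> J \<and> (\<exists>v\<in>U. \<exists>J'. (k, f z v, J') \<in> traj 0 0 \<and> r z v + J' \<le> J)"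
      if "(k, z, J) \<in> traj 0 0" for k z J
      using traj_props[OF init(1) that] by blast
    ultimately have "sustainable (traj 0 0) (D 0)"
      using finite_traj unfolding sustainable_def by blast
    with base show ?case by simp
  next
    case (Suc i)
    then have IH: "sustainable (S i) (D i)" "0 \<in> I i" "traj 0 0 \<subseteq> S i"
      "\<And>z J. (0, z, J) \<in> S i \<Longrightarrow> (0, z, J) \<in> traj 0 0" and i: "i < n" by auto
    define S' where "S' = S i \<union> traj (Suc i) 1"
    define UI where "UI = {k \<in> I i \<union> {Suc i}. \<exists>z J. (k, z, J) \<in> S' \<and> worst_case_CVaR \<beta> g (D (Suc i)) z > \<delta>}"
    have I_Suc: "I (Suc i) = (I i \<union> {Suc i}) - UI"
      and S_Suc: "S (Suc i) = {(k, z, J) \<in> S'. k \<in> I (Suc i)}"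
      by (simp_all add: I_def S_eq S'_def UI_def traj_def Let_def split: prod.splits)
    have "(0, xS, cost_to_go r (x 0) (u 0) 0) \<in> traj 0 0"
      using init(2) by (auto simp: traj_def)
    with IH(3) have "xS \<in> safe_states (S i)" unfolding safe_states_def by blast
    then have c: "completed_trajectory (x (Suc i)) (u (Suc i)) (T (Suc i))"
      using MPC_run_completed[OF IH(1) _ attained run finite_length] i by blast
    have step: "z \<in> X \<and> 0 \<le> J \<and> (\<exists>v\<in>U. \<exists>J'. (k, f z v, J') \<in> S' \<and> r z v + J' \<le> J)"
      if mem: "(k, z, J) \<in> S'" for k z J
    proof (cases "(k, z, J) \<in> S i")
      case True
      then show ?thesis using sustainableD(1,3,4)[OF IH(1) True] unfolding S'_def by blast
    next
      case False
      then have "(k, z, J) \<in> traj (Suc i) 1" using mem by (simp add: S'_def)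
      from traj_props[OF c this] show ?thesis unfolding S'_def by blast
    qed
    have index0: "(0, z, J) \<in> traj 0 0" if "(0, z, J) \<in> S'" for z J
      using that IH(4) by (auto simp: S'_def traj_def)
    have risk: "worst_case_CVaR \<beta> g (D (Suc i)) z \<le> \<delta>" if "(k, z, J) \<in> S (Suc i)" for k z J
      using that unfolding S_Suc I_Suc UI_def by force
    have "finite S'" using IH(1) finite_traj by (simp add: S'_def sustainable_def)
    then have "finite (S (Suc i))" by (rule rev_finite_subset) (auto simp: S_Suc)
    moreover have "z \<in> X \<and> 0 \<le> J \<and> (\<exists>v\<in>U. \<exists>J'. (k, f z v, J') \<in> S (Suc i) \<and> r z v + J' \<le> J)"
      if "(k, z, J) \<in> S (Suc i)" for k z J
      using that step[of k z J] by (auto simp: S_Suc)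
    ultimately have "sustainable (S (Suc i)) (D (Suc i))"
      using risk unfolding sustainable_def by blast
    moreover have "worst_case_CVaR \<beta> g (D (Suc i)) z \<le> \<delta>" if "(0, z, J) \<in> S'" for z J
      using index0[OF that] risk0 by (auto simp: traj_def)
    then have "0 \<notin> UI" by (force simp: UI_def)
    then have 0: "0 \<in> I (Suc i)" using IH(2) by (simp add: I_Suc)
    moreover have "traj 0 0 \<subseteq> S (Suc i)"
      using IH(3) 0 by (auto simp: S_Suc S'_def traj_def)
    ultimately show ?case using index0 by (auto simp: S_Suc)
  qed
  then have "sustainable (S n) (D n)" "traj 0 0 \<subseteq> S n" by auto
  moreover have "(0, xS, cost_to_go r (x 0) (u 0) 0) \<in> traj 0 0"
    using init(2) by (auto simp: traj_def)
  ultimately show "sustainable (S n) (D n)" "xS \<in> safe_states (S n)"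
    unfolding safe_states_def by blast+
qed

end


section \<open>Convergence of every iteration\<close>

theorem propositionV2:
  fixes f :: "real ^ 'nx \<Rightarrow> real ^ 'nu \<Rightarrow> real ^ 'nx"
    and X :: "(real ^ 'nx) set" and U :: "(real ^ 'nu) set" and W :: "(real ^ 'nw) set"
    and xS xF :: "real ^ 'nx"
    and r :: "real ^ 'nx \<Rightarrow> real ^ 'nu \<Rightarrow> real"
    and g :: "real ^ 'nx \<Rightarrow> real ^ 'nw \<Rightarrow> real"
    and P :: "(real ^ 'nw) measure"
    and \<delta> \<beta> \<zeta> :: real and K :: nat
    and DD :: "(real ^ 'nw) list \<Rightarrow> (real ^ 'nw) measure set"
    and M :: "'o measure" and \<xi> :: "nat \<Rightarrow> 'o \<Rightarrow> real ^ 'nw" and \<omega> :: 'o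
    and N T :: "nat \<Rightarrow> nat"
    and x :: "nat \<Rightarrow> nat \<Rightarrow> real ^ 'nx" and u :: "nat \<Rightarrow> nat \<Rightarrow> real ^ 'nu"
    and D :: "nat \<Rightarrow> (real ^ 'nw) measure set" and S :: "nat \<Rightarrow> (real ^ 'nx) safe_set"
    and j :: nat
  assumes X: "compact X" "convex X" and U: "compact U" "convex U" "0 \<in> U"
    and xS: "xS \<in> X" and xF: "xF \<in> X" "f xF 0 = xF"
    and r_cont: "continuous_on (X \<times> U) (\<lambda>(y, v). r y v)"
    and r_nonneg: "\<forall>y\<in>X. \<forall>v\<in>U. 0 \<le> r y v"
    and r_zero: "r xF 0 = 0"
    and r_pos: "\<forall>(y, v) \<in> X \<times> U - {(xF, 0)}. 0 < r y v"
    and W: "compact W" and P: "P \<in> distributions_on W"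
    and g_cont: "continuous_on (X \<times> W) (\<lambda>(y, w). g y w)"
    and \<delta>: "0 < \<delta>" and \<beta>: "0 < \<beta>" "\<beta> < 1" and \<zeta>: "0 < \<zeta>" "\<zeta> < 1" and K: "1 \<le> K"
    and DD: "\<forall>ws. ws \<noteq> [] \<and> set ws \<subseteq> W \<longrightarrow> closedin (weak_topology W) (DD ws) \<and> DD ws \<noteq> {}"
    \<comment> \<open>i.i.d. samples of \<open>w\<close> and a realization \<open>\<omega>\<close> of them\<close>
    and M: "prob_space M"
    and samples_indep: "prob_space.indep_vars M (\<lambda>_. restrict_space borel W) \<xi> UNIV"
    and samples_distr: "\<forall>n. distr M (restrict_space borel W) (\<xi> n) = P"
    and \<omega>: "\<omega> \<in> space M"
    \<comment> \<open>datasets, ambiguity sets and sampled safe sets\<close>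
    and N0: "1 \<le> N 0" and N_Suc: "\<forall>i. N (Suc i) = N i + T (Suc i)"
    and D: "\<forall>i. D i = DD (map (\<lambda>n. \<xi> n \<omega>) [0..<N i])"
    and S: "\<forall>i. S i = sampled_safe_set r g \<delta> \<beta> D x u T i"
    and coverage: "\<forall>i<j. \<zeta> \<le> measure (Pi\<^sub>M {..<N i} (\<lambda>_. P))
           {ws \<in> space (Pi\<^sub>M {..<N i} (\<lambda>_. P)). P \<in> DD (map ws [0..<N i])}"
    \<comment> \<open>the run, up to and including iteration \<open>j\<close>\<close>
    and init: "robustly_safe_trajectory f X U xS xF W g \<delta> (x 0) (u 0) (T 0)"
    and attained: "\<forall>i\<in>{1..j}. \<forall>y.
           fhp_feasible f X U g \<delta> \<beta> K (S (i - 1)) (D (i - 1)) y \<noteq> {} \<longrightarrow>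
           fhp_solutions f X U r g \<delta> \<beta> K (S (i - 1)) (D (i - 1)) y \<noteq> {}"
    and run: "\<forall>i\<in>{1..j}.
           DR_MPC f X U xS xF r g \<delta> \<beta> K (S (i - 1)) (D (i - 1)) (x i) (u i)"
    and preceding_finite: "\<forall>i\<in>{1..<j}. has_finite_length xF (x i) (T i)"
    and j: "1 \<le> j"
  shows "x j \<longlonglongrightarrow> xF"
proof -
  interpret mpc_problem f X U xF r g \<delta> \<beta> K
    using U xF r_nonneg r_zero K by unfold_locales auto
  have N: "1 \<le> N i" for i
    by (induction i) (use N0 N_Suc in auto)
  \<comment> \<open>The samples take values in \<open>W\<close> at every point of the sample space, not just almost surely.\<close>
  have sample: "\<xi> n \<omega> \<in> W" for n
  proof -
    have "\<xi> n \<in> measurable M (restrict_space borel W)"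
      using samples_indep by (simp add: prob_space.indep_vars_def[OF M])
    from measurable_space[OF this \<omega>] show ?thesis
      by (simp add: space_restrict_space)
  qed
  have D_props: "D i \<noteq> {}" "D i \<subseteq> distributions_on W" for i
  proof -
    have "map (\<lambda>n. \<xi> n \<omega>) [0..<N i] \<noteq> []" using N[of i] by simp
    moreover have "set (map (\<lambda>n. \<xi> n \<omega>) [0..<N i]) \<subseteq> W" using sample by auto
    ultimately have "closedin (weak_topology W) (D i)" and ne: "D i \<noteq> {}"
      using DD D by auto
    then have "D i \<subseteq> topspace (weak_topology W)" by (simp add: closedin_subset)
    also have "\<dots> \<subseteq> distributions_on W"
      by (auto simp: weak_topology_def)
    finally show "D i \<subseteq> distributions_on W" .
    from ne show "D i \<noteq> {}" .
  qed
  have safe0: "x 0 t \<in> X" "\<And>w. w \<in> W \<Longrightarrow> g (x 0 t) w \<le> \<delta>" if "t \<le> T 0" for t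
    using init that by (auto simp: robustly_safe_trajectory_def)
  have risk0: "worst_case_CVaR \<beta> g (D i) (x 0 t) \<le> \<delta>" if t: "t \<le> T 0" for i t
  proof (rule worst_case_CVaR_le[OF W D_props])
    have "continuous_on W (\<lambda>w. (\<lambda>(y, w). g y w) (x 0 t, w))"
      by (rule continuous_on_compose2[OF g_cont]) (auto intro!: continuous_intros safe0 t)
    then show "continuous_on W (g (x 0 t))" by simp
  qed (use safe0 t \<beta> in auto)
  have "x 0 t \<in> X \<and> u 0 t \<in> U \<and> x 0 (Suc t) = f (x 0 t) (u 0 t)" for t
    using init U(3) xF by (cases "t < T 0") (auto simp: robustly_safe_trajectory_def)
  then have init': "completed_trajectory (x 0) (u 0) (T 0)" "x 0 0 = xS"
    using init by (auto simp: completed_trajectory_def robustly_safe_trajectory_def)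
  have S_fun: "sampled_safe_set r g \<delta> \<beta> D x u T = S" using S by auto
  obtain n where n: "j = Suc n" using j by (cases j) auto
  have attained': "\<forall>y. feasible (S i) (D i) y \<noteq> {} \<longrightarrow> solutions (S i) (D i) y \<noteq> {}"
    if "i \<le> n" for i
    using attained[rule_format, of "Suc i"] that by (simp add: n)
  have run': "DR_MPC f X U xS xF r g \<delta> \<beta> K (S i) (D i) (x (Suc i)) (u (Suc i))" if "i \<le> n" for i
    using run[rule_format, of "Suc i"] that by (simp add: n)
  have finite_length: "x (Suc i) (T (Suc i)) = xF" if "i < n" for i
    using preceding_finite[rule_format, of "Suc i"] that by (simp add: n has_finite_length_def)
  have sust: "sustainable (S n) (D n)" "xS \<in> safe_states (S n)"
    using sampled_safe_set_sustainable[of x u T xS D n, unfolded S_fun,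
        OF init' risk0 attained' run' finite_length] by auto
  note last_run = sust attained'[OF order_refl] run'[OF order_refl]
  show ?thesis
    unfolding n
    by (rule tendsto_of_cost_tendsto_zero[OF X(1) U(1) r_cont r_pos
          MPC_run_admissible(1,2)[OF last_run] MPC_run_cost_tendsto_zero[OF last_run]])
qed

end
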